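(* Let $G$ be a finite group of complex $n\times n$ unitary matrices generated by reflections acting on $V=\mathbb{C}^n$, and let $\chi$ be a multiplicative character of $G$. Then $$\Omega^\chi\subset Q_\chi\,\Omega(\mathcal{A}_\chi),$$ where $\Omega^\chi$ is the module of $\chi$-invariant differential forms and $\Omega(\mathcal{A}_\chi)$ is the module of logarithmic forms of the multiarrangement $\mathcal{A}_\chi$ defined by $Q_\chi$.
   Context: A reflection is a non-identity unitary matrix of finite order fixing a hyperplane of $V=\mathbb{C}^n$ pointwise. $S=\mathbb{C}[x_1,\ldots,x_n]$ is the ring of polynomials on $V$. $G$ acts contragrediently: $(gf)(v)=f(g^{-1}v)$ for $f\in S$. A multiplicative character is a homomorphism $\chi:G\to\mathbb{C}^*$; $\det$ denotes the determinant character of $G$ on $V$. Differential $p$-forms: $\Omega^p=\bigoplus_{1\le i_1<\cdots<i_p\le n}S\,dx_{i_1}\wedge\cdots\wedge dx_{i_p}\simeq S\otimes\bigwedge^pV^*$, with the induced $G$-action ($g\,dx_i=d(gx_i)$). $(\Omega^p)^\chi=\{\omega\in\Omega^p: g\omega=\chi(g)\omega\ \text{for all } g\in G\}$, and $\Omega^\chi=\bigoplus_{p\ge0}(\Omega^p)^\chi$. Let $\mathcal{A}$ be the set of reflecting hyperplanes of $G$; for $H\in\mathcal{A}$ let $\alpha_H\in S$ be a linear form with kernel $H$, $G_H$ the cyclic subgroup of elements of $G$ fixing $H$ pointwise, $s_H$ a generator of $G_H$, of order $o(s_H)$, and $a_H(\chi)$ the least integer with $0\le a_H(\chi)<o(s_H)$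 and $\chi(s_H)=\det(s_H)^{-a_H(\chi)}$. Put $Q_\chi=\prod_{H\in\mathcal{A}}\alpha_H^{a_H(\chi)}$ (well defined up to a nonzero scalar; fix a choice). $\mathcal{A}_\chi$ is the multiarrangement consisting of the hyperplanes $H\in\mathcal{A}$, each with multiplicity $a_H(\chi)$. Its logarithmic $p$-forms are $$\Omega^p(\mathcal{A}_\chi)=\left\{\frac{\omega}{Q_\chi}:\ \omega\in\Omega^p\ \text{and}\ \omega\wedge d\alpha_H\in\alpha_H^{a_H(\chi)}\,\Omega^{p+1}\ \text{for all } H\in\mathcal{A}\right\},$$ and $\Omega(\mathcal{A}_\chi)=\bigoplus_{p\ge0}\Omega^p(\mathcal{A}_\chi)$. *)

theory Defs
  imports
    "HOL-Analysis.Analysis"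
    "HOL-Library.Poly_Mapping"
    "HOL-Computational_Algebra.Polynomial_Factorial"
    "HOL-Algebra.Generated_Groups"
    "HOL-Algebra.Multiplicative_Group"
begin

section \<open>Unitary reflection groups\<close>

type_synonym 'n cvec = "(complex, 'n) vec"
type_synonym 'n cmat = "('n cvec, 'n) vec"

definition adjoint_matrix :: "('n::finite) cmat \<Rightarrow> 'n cmat" where
  "adjoint_matrix A = map_matrix cnj (transpose A)"

definition unitary_matrix :: "('n::finite) cmat \<Rightarrow> bool" where
  "unitary_matrix A \<longleftrightarrow> adjoint_matrix A ** A = mat 1 \<and> A ** adjoint_matrix A = mat 1"

definition unitary_group :: "('n::finite) cmat monoid" where
  "unitary_group = \<lparr>carrier = {A. unitary_matrix A}, mult = (**), one = mat 1\<rparr>"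

definition complex_units :: "complex monoid" where
  "complex_units = \<lparr>carrier = - {0}, mult = (*), one = 1\<rparr>"

definition hyperplane :: "('n::finite) cvec set \<Rightarrow> bool" where
  "hyperplane H \<longleftrightarrow> vec.subspace H \<and> vec.dim H + 1 = CARD('n)"

definition fixes_pointwise :: "('n::finite) cmat \<Rightarrow> 'n cvec set \<Rightarrow> bool" where
  "fixes_pointwise g H \<longleftrightarrow> (\<forall>v\<in>H. g *v v = v)"

definition reflection :: "('n::finite) cmat \<Rightarrow> bool" where
  "reflection g \<longleftrightarrow> unitary_matrix g \<and> g \<noteq> mat 1 \<and>
     (\<exists>k::nat. k > 0 \<and> g [^]\<^bsub>unitary_group\<^esub> k = mat 1) \<and>
     (\<exists>H. hyperplane H \<and> fixes_pointwise g H)"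

definition reflection_group :: "('n::finite) cmat set \<Rightarrow> bool" where
  "reflection_group G \<longleftrightarrow> finite G \<and> subgroup G unitary_group \<and>
     generate unitary_group {g \<in> G. reflection g} = G"

definition mult_character :: "('n::finite) cmat set \<Rightarrow> ('n cmat \<Rightarrow> complex) \<Rightarrow> bool" where
  "mult_character G ch \<longleftrightarrow> ch \<in> hom (unitary_group\<lparr>carrier := G\<rparr>) complex_units"

definition reflecting_hyperplanes :: "('n::finite) cmat set \<Rightarrow> 'n cvec set set" where
  "reflecting_hyperplanes G =
     {H. hyperplane H \<and> (\<exists>g\<in>G. reflection g \<and> fixes_pointwise g H)}"

definition pointwise_stabilizer ::
    "('n::finite) cmat set \<Rightarrow> 'n cvec set \<Rightarrow> 'n cmat set" where
  "pointwise_stabilizer G H = {g \<in> G. fixes_pointwise g H}"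

text \<open>The exponent \<open>a\<^sub>H(ch)\<close>, where \<open>g\<close> is the chosen generator of the pointwise stabilizer of \<open>H\<close>.\<close>

definition char_exponent ::
    "(('n::finite) cmat \<Rightarrow> complex) \<Rightarrow> 'n cmat \<Rightarrow> nat" where
  "char_exponent ch g =
     (LEAST a. a < group.ord unitary_group g \<and> ch g = det g powi (- int a))"

lemma unitary_matrix_mult:
  assumes "unitary_matrix A" "unitary_matrix B"
  shows "unitary_matrix (A ** B)"
proof -
  have adj: "adjoint_matrix (A ** B) = adjoint_matrix B ** adjoint_matrix A"
    by (simp add: adjoint_matrix_def map_matrix_def transpose_def matrix_matrix_mult_def
        vec_eq_iff mult.commute)
  have "adjoint_matrix (A ** B) ** (A ** B) = adjoint_matrix B ** (adjoint_matrix A ** A) ** B"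
    unfolding adj by (simp add: matrix_mul_assoc)
  moreover have "(A ** B) ** adjoint_matrix (A ** B) = A ** (B ** adjoint_matrix B) ** adjoint_matrix A"
    unfolding adj by (simp add: matrix_mul_assoc)
  ultimately show ?thesis
    using assms by (simp add: unitary_matrix_def)
qed

lemma group_unitary_group: "group (unitary_group :: 'n::finite cmat monoid)"
proof (rule groupI)
  have "adjoint_matrix (mat 1 :: 'n cmat) = mat 1"
    by (auto simp: adjoint_matrix_def map_matrix_def transpose_def mat_def vec_eq_iff)
  then show "\<one>\<^bsub>unitary_group\<^esub> \<in> carrier (unitary_group :: 'n cmat monoid)"
    by (simp add: unitary_group_def unitary_matrix_def)
next
  fix A :: "'n::finite cmat"
  assume "A \<in> carrier unitary_group"
  moreover have "adjoint_matrix (adjoint_matrix A) = A"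
    by (simp add: adjoint_matrix_def map_matrix_def transpose_def vec_eq_iff)
  ultimately have "adjoint_matrix A \<in> carrier unitary_group"
      "adjoint_matrix A \<otimes>\<^bsub>unitary_group\<^esub> A = \<one>\<^bsub>unitary_group\<^esub>"
    by (simp_all add: unitary_group_def unitary_matrix_def)
  then show "\<exists>B\<in>carrier unitary_group. B \<otimes>\<^bsub>unitary_group\<^esub> A = \<one>\<^bsub>unitary_group\<^esub>" ..
qed (auto simp: unitary_group_def unitary_matrix_mult matrix_mul_assoc)


section \<open>Polynomials on \<open>\<complex>\<^sup>n\<close>\<close>

type_synonym 'n mpoly = "('n \<Rightarrow>\<^sub>0 nat) \<Rightarrow>\<^sub>0 complex"

definition Const :: "complex \<Rightarrow> 'n mpoly" where
  "Const c = Poly_Mapping.single 0 c"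

definition Var :: "'n \<Rightarrow> 'n mpoly" where
  "Var i = Poly_Mapping.single (Poly_Mapping.single i 1) 1"

definition poly_value :: "('n::finite) mpoly \<Rightarrow> 'n cvec \<Rightarrow> complex" where
  "poly_value f v =
     (\<Sum>m\<in>Poly_Mapping.keys f. Poly_Mapping.lookup f m * (\<Prod>i\<in>UNIV. (v $ i) ^ Poly_Mapping.lookup m i))"

definition poly_subst :: "('n::finite \<Rightarrow> 'n mpoly) \<Rightarrow> 'n mpoly \<Rightarrow> 'n mpoly" where
  "poly_subst h f =
     (\<Sum>m\<in>Poly_Mapping.keys f. Const (Poly_Mapping.lookup f m) * (\<Prod>i\<in>UNIV. h i ^ Poly_Mapping.lookup m i))"

definition partial_deriv :: "'n \<Rightarrow> 'n mpoly \<Rightarrow> 'n mpoly" where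
  "partial_deriv i f =
     (\<Sum>m\<in>Poly_Mapping.keys f. Poly_Mapping.single (m - Poly_Mapping.single i 1)
        (of_nat (Poly_Mapping.lookup m i) * Poly_Mapping.lookup f m))"

definition linear_poly :: "('n::finite) cvec \<Rightarrow> 'n mpoly" where
  "linear_poly a = (\<Sum>i\<in>UNIV. Const (a $ i) * Var i)"

definition linear_form_with_kernel :: "('n::finite) mpoly \<Rightarrow> 'n cvec set \<Rightarrow> bool" where
  "linear_form_with_kernel f H \<longleftrightarrow> (\<exists>a. f = linear_poly a) \<and> {v. poly_value f v = 0} = H"

text \<open>
  The contragredient action \<open>(g f)(v) = f(g\<^sup>-\<^sup>1 v)\<close>; see \<open>poly_value_poly_act\<close> below.
\<close>

definition poly_act :: "('n::finite) cmat \<Rightarrow> 'n mpoly \<Rightarrow> 'n mpoly" where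
  "poly_act g f = poly_subst (\<lambda>i. linear_poly (row i (matrix_inv g))) f"

lemma poly_value_superset:
  assumes "finite K" "Poly_Mapping.keys f \<subseteq> K"
  shows "poly_value f v =
    (\<Sum>m\<in>K. Poly_Mapping.lookup f m * (\<Prod>i\<in>UNIV. (v $ i) ^ Poly_Mapping.lookup m i))"
  unfolding poly_value_def using assms
  by (intro sum.mono_neutral_left) (auto simp: in_keys_iff)

lemma poly_value_add: "poly_value (f + g) v = poly_value f v + poly_value g v"
proof -
  let ?K = "Poly_Mapping.keys f \<union> Poly_Mapping.keys g"
  have "Poly_Mapping.keys (f + g) \<subseteq> ?K"
    by (rule Poly_Mapping.keys_add)
  then show ?thesis
    by (simp add: poly_value_superset[of ?K] lookup_add distrib_right sum.distrib)
qed

lemma poly_value_zero [simp]: "poly_value 0 v = 0"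
  by (simp add: poly_value_def)

lemma poly_value_single:
  "poly_value (Poly_Mapping.single m c) v = c * (\<Prod>i\<in>UNIV. (v $ i) ^ Poly_Mapping.lookup m i)"
  by (simp add: poly_value_superset[of "{m}"])

lemma poly_value_sum: "poly_value (\<Sum>x\<in>A. f x) v = (\<Sum>x\<in>A. poly_value (f x) v)"
  by (induction A rule: infinite_finite_induct) (simp_all add: poly_value_add)

lemma mpoly_induct [case_names single add]:
  fixes f :: "'n mpoly"
  assumes "\<And>m c. P (Poly_Mapping.single m c)" and "\<And>f g. P f \<Longrightarrow> P g \<Longrightarrow> P (f + g)"
  shows "P f"
proof -
  have "P (\<Sum>m\<in>K. Poly_Mapping.single m (Poly_Mapping.lookup f m))" for K
  proof (induction K rule: infinite_finite_induct)
    case (insert m K)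
    then show ?case using assms by simp
  qed (use assms(1)[of 0 0] in simp_all)
  moreover have "f = (\<Sum>m\<in>Poly_Mapping.keys f. Poly_Mapping.single m (Poly_Mapping.lookup f m))"
    by (rule poly_mapping_eqI) (simp add: lookup_sum lookup_single when_def in_keys_iff)
  ultimately show ?thesis by metis
qed

lemma poly_value_mult: "poly_value (f * g) v = poly_value f v * poly_value g v"
proof (induction f rule: mpoly_induct)
  case (single m c)
  show ?case
  proof (induction g rule: mpoly_induct)
    case (single l d)
    show ?case
      by (simp add: mult_single poly_value_single lookup_add power_add prod.distrib)
  next
    case (add g1 g2)
    then show ?case
      by (simp add: distrib_left poly_value_add)
  qed
next
  case (add f1 f2)
  then show ?case
    by (simp add: distrib_right poly_value_add)
qed

lemma poly_value_one [simp]: "poly_value 1 v = 1"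
  by (simp flip: single_one add: poly_value_single)

lemma poly_value_power: "poly_value (f ^ k) v = poly_value f v ^ k"
  by (induction k) (simp_all add: poly_value_mult)

lemma poly_value_prod: "poly_value (\<Prod>x\<in>A. f x) v = (\<Prod>x\<in>A. poly_value (f x) v)"
  by (induction A rule: infinite_finite_induct) (simp_all add: poly_value_mult)

lemma poly_value_Const [simp]: "poly_value (Const c) v = c"
  by (simp add: Const_def poly_value_single)

lemma poly_value_Var [simp]: "poly_value (Var i) v = v $ i"
proof -
  have "(\<Prod>j\<in>UNIV. v $ j ^ Poly_Mapping.lookup (Poly_Mapping.single i (1::nat)) j) =
        (\<Prod>j\<in>UNIV. if j = i then v $ j else 1)"
    by (intro prod.cong) (auto simp: lookup_single when_def)
  then show ?thesis
    by (simp add: Var_def poly_value_single)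
qed

lemma poly_value_linear_poly: "poly_value (linear_poly a) v = (\<Sum>i\<in>UNIV. a $ i * v $ i)"
  by (simp add: linear_poly_def poly_value_sum poly_value_mult)

lemma poly_value_poly_act: "poly_value (poly_act g f) v = poly_value f (matrix_inv g *v v)"
  by (simp add: poly_act_def poly_subst_def poly_value_sum poly_value_mult poly_value_prod
      poly_value_power poly_value_linear_poly poly_value_def[of f] matrix_vector_mult_def row_def)


section \<open>Differential forms\<close>

text \<open>
  A form \<open>\<Sum>\<^sub>I \<omega>\<^sub>I dx\<^sub>I\<close>, where \<open>dx\<^sub>I\<close> is the wedge product of the \<open>dx\<^sub>i\<close> with
  \<open>i \<in> I\<close> in increasing order of the index type, is the vector of its coefficients \<open>\<omega>\<^sub>I\<close>.  The coefficients lie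
  in the polynomial ring, or in its fraction field for rational forms.
\<close>

type_synonym ('n, 'a) form = "'a ^ ('n set)"

definition homogeneous_forms :: "nat \<Rightarrow> ('n::finite, 'a::zero) form set" where
  "homogeneous_forms p = {\<omega>. \<forall>I. card I \<noteq> p \<longrightarrow> \<omega> $ I = 0}"

text \<open>\<open>dx\<^sub>I \<and> dx\<^sub>J = shuffle_sign I J dx\<^bsub>I \<union> J\<^esub>\<close> for disjoint \<open>I\<close> and \<open>J\<close>.\<close>

definition shuffle_sign :: "('n::linorder) set \<Rightarrow> 'n set \<Rightarrow> 'a::comm_ring_1" where
  "shuffle_sign I J = (- 1) ^ card {(i, j). i \<in> I \<and> j \<in> J \<and> j < i}"

definition wedge ::
    "('n::{finite,linorder}, 'a::comm_ring_1) form \<Rightarrow> ('n, 'a) form \<Rightarrow> ('n, 'a) form" where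
  "wedge \<omega> \<eta> = (\<chi> K. \<Sum>I\<in>Pow K. shuffle_sign I (K - I) * \<omega> $ I * \<eta> $ (K - I))"

definition wedge_list :: "('n::{finite,linorder}, 'a::comm_ring_1) form list \<Rightarrow> ('n, 'a) form" where
  "wedge_list \<omega>s = foldr wedge \<omega>s (axis {} 1)"

lemma wedge_axis:
  fixes I J :: "'n::{finite,linorder} set"
  assumes "I \<inter> J = {}"
  shows "wedge (axis I 1) (axis J (1::'a::comm_ring_1)) = shuffle_sign I J *s axis (I \<union> J) 1"
proof -
  have "wedge (axis I 1) (axis J 1) $ K = (shuffle_sign I J *s axis (I \<union> J) (1::'a)) $ K" for K
  proof -
    have "wedge (axis I 1) (axis J 1) $ K =
        (\<Sum>L\<in>Pow K. if L = I then shuffle_sign I (K - I) * axis J (1::'a) $ (K - I) else 0)"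
      unfolding wedge_def vec_lambda_beta by (intro sum.cong) (auto simp: axis_def)
    also have "\<dots> = (if I \<subseteq> K then shuffle_sign I (K - I) * axis J (1::'a) $ (K - I) else 0)"
      by (simp add: sum.delta)
    also have "\<dots> = (shuffle_sign I J *s axis (I \<union> J) (1::'a)) $ K"
    proof (cases "K = I \<union> J")
      case True
      then have "K - I = J" using assms by auto
      with True show ?thesis by (simp add: axis_def)
    next
      case False
      then have "I \<subseteq> K \<Longrightarrow> K - I \<noteq> J" by auto
      with False show ?thesis by (auto simp: axis_def)
    qed
    finally show ?thesis .
  qed
  then show ?thesis by (simp add: vec_eq_iff)
qed

lemma wedge_list_dx:
  "wedge_list (map (\<lambda>i. axis {i} 1) (sorted_list_of_set I)) =
     (axis I 1 :: ('n::{finite,linorder}, 'a::comm_ring_1) form)"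
proof -
  have "wedge_list (map (\<lambda>i. axis {i} 1) xs) = (axis (set xs) 1 :: ('n, 'a) form)"
    if "sorted_wrt (<) xs" for xs
    using that
  proof (induction xs)
    case Nil
    then show ?case by (simp add: wedge_list_def)
  next
    case (Cons x xs)
    then have "{x} \<inter> set xs = {}"
      and *: "{(i, j). i = x \<and> j \<in> set xs \<and> j < i} = {}"
      by force+
    moreover from * have "shuffle_sign {x} (set xs) = (1::'a)"
      by (simp only: shuffle_sign_def singleton_iff card.empty power_0)
    moreover have "wedge_list (map (\<lambda>i. axis {i} 1) xs) = (axis (set xs) 1 :: ('n, 'a) form)"
      using Cons by simp
    ultimately show ?case
      using wedge_axis[of "{x}" "set xs", where 'a = 'a] by (simp add: wedge_list_def)
  qed
  from this[of "sorted_list_of_set I"] show ?thesis by simp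
qed

definition differential :: "('n::finite) mpoly \<Rightarrow> ('n, 'n mpoly) form" where
  "differential f = (\<Sum>i\<in>UNIV. partial_deriv i f *s axis {i} 1)"

definition form_act ::
    "('n::{finite,linorder}) cmat \<Rightarrow> ('n, 'n mpoly) form \<Rightarrow> ('n, 'n mpoly) form" where
  "form_act g \<omega> = (\<Sum>I\<in>UNIV. poly_act g (\<omega> $ I) *s
     wedge_list (map (\<lambda>i. differential (poly_act g (Var i))) (sorted_list_of_set I)))"

definition graded_sum :: "(nat \<Rightarrow> 'b::comm_monoid_add set) \<Rightarrow> 'b set" where
  "graded_sum M = {(\<Sum>p\<in>P. \<eta> p) | P \<eta>. finite P \<and> (\<forall>p\<in>P. \<eta> p \<in> M p)}"

definition invariant_forms_deg ::
    "('n::{finite,linorder}) cmat set \<Rightarrow> ('n cmat \<Rightarrow> complex) \<Rightarrow> nat \<Rightarrow>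
     ('n, 'n mpoly) form set" where
  "invariant_forms_deg G ch p =
     {\<omega> \<in> homogeneous_forms p. \<forall>g\<in>G. form_act g \<omega> = Const (ch g) *s \<omega>}"

definition invariant_forms ::
    "('n::{finite,linorder}) cmat set \<Rightarrow> ('n cmat \<Rightarrow> complex) \<Rightarrow>
     ('n, 'n mpoly) form set" where
  "invariant_forms G ch = graded_sum (invariant_forms_deg G ch)"

definition rational_form ::
    "('n::{finite,linorder}, 'n mpoly) form \<Rightarrow> ('n, 'n mpoly fract) form" where
  "rational_form \<omega> = (\<chi> I. to_fract (\<omega> $ I))"


section \<open>Logarithmic forms of a multiarrangement\<close>

text \<open>
  A multiarrangement is given by its set of hyperplanes \<open>A\<close>, a defining linear form
  \<open>\<alpha> H\<close> and a multiplicity \<open>m H\<close> for each \<open>H \<in> A\<close>.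
\<close>

definition defining_poly ::
    "('n::finite) cvec set set \<Rightarrow> ('n cvec set \<Rightarrow> 'n mpoly) \<Rightarrow>
     ('n cvec set \<Rightarrow> nat) \<Rightarrow> 'n mpoly" where
  "defining_poly A \<alpha> m = (\<Prod>H\<in>A. \<alpha> H ^ m H)"

definition log_forms_deg ::
    "('n::{finite,linorder}) cvec set set \<Rightarrow> ('n cvec set \<Rightarrow> 'n mpoly) \<Rightarrow>
     ('n cvec set \<Rightarrow> nat) \<Rightarrow> nat \<Rightarrow> ('n, 'n mpoly fract) form set" where
  "log_forms_deg A \<alpha> m p =
     {inverse (to_fract (defining_poly A \<alpha> m)) *s rational_form \<omega> | \<omega>.
        \<omega> \<in> homogeneous_forms p \<and>
        (\<forall>H\<in>A. \<exists>\<eta>\<in>homogeneous_forms (p + 1). wedge \<omega> (differential (\<alpha> H)) = \<alpha> H ^ m H *s \<eta>)}"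

definition log_forms ::
    "('n::{finite,linorder}) cvec set set \<Rightarrow> ('n cvec set \<Rightarrow> 'n mpoly) \<Rightarrow>
     ('n cvec set \<Rightarrow> nat) \<Rightarrow> ('n, 'n mpoly fract) form set" where
  "log_forms A \<alpha> m = graded_sum (log_forms_deg A \<alpha> m)"

end

theory Submission
  imports Defs
begin

text \<open>
  Let \<open>s\<close> generate the pointwise stabilizer of \<open>H = ker \<alpha>\<close>.  Then \<open>s\<^sup>-\<^sup>1 = I + c \<alpha>\<close> is a
  rank-one perturbation of the identity, so \<open>s \<alpha> = \<mu> \<alpha>\<close> with \<open>\<mu> = det s\<^sup>-\<^sup>1\<close>, and
  \<open>s dx\<^sub>i\<close> differs from \<open>dx\<^sub>i\<close> by a multiple of \<open>d\<alpha>\<close>.  Hence, after wedging with \<open>d\<alpha>\<close>,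
  \<open>s\<close> acts on a form through its coefficients only: if \<open>\<omega>\<close> is \<open>\<chi>\<close>-invariant, every
  coefficient \<open>f\<close> of \<open>\<omega> \<and> d\<alpha>\<close> satisfies \<open>s f = \<chi>(s) f = \<mu>\<^sup>a f\<close>, where \<open>a = a\<^sub>H(\<chi>)\<close>.
  As \<open>\<mu>\<close> is a primitive root of unity of order \<open>o(s) > a\<close>, reducing such an equation modulo
  \<open>\<alpha>\<close>, where \<open>s\<close> acts trivially, shows \<open>\<alpha> | f\<close> as long as \<open>a > 0\<close>; dividing out one factor
  at a time gives \<open>\<alpha>\<^sup>a | f\<close>.
\<close>

section \<open>Substitution in polynomials\<close>

lemma Const_0 [simp]: "Const 0 = 0"
  by (simp add: Const_def)

lemma Const_1 [simp]: "Const 1 = 1"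
  by (simp add: Const_def)

lemma Const_add: "Const (c + d) = Const c + Const d"
  by (simp add: Const_def single_add)

lemma Const_mult: "Const (c * d) = Const c * Const d"
  by (simp add: Const_def mult_single)

lemma Const_sum: "Const (\<Sum>x\<in>A. f x) = (\<Sum>x\<in>A. Const (f x))"
  by (induction A rule: infinite_finite_induct) (simp_all add: Const_add)

lemma Const_eq_iff [simp]: "Const c = Const d \<longleftrightarrow> c = d"
  unfolding Const_def by (metis lookup_single_eq)

lemma Const_eq_0_iff [simp]: "Const c = 0 \<longleftrightarrow> c = 0"
  using Const_eq_iff[of c 0] by simp

lemma Const_eq_1_iff [simp]: "Const c = 1 \<longleftrightarrow> c = 1"
  using Const_eq_iff[of c 1] by simp

lemma Var_power: "Var i ^ k = Poly_Mapping.single (Poly_Mapping.single i k) 1"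
  by (induction k) (simp_all add: Var_def mult_single flip: single_add)

lemma prod_single_one:
  "(\<Prod>x\<in>A. Poly_Mapping.single (m x) (1::'a::comm_semiring_1)) =
     Poly_Mapping.single (\<Sum>x\<in>A. m x :: 'b::comm_monoid_add) 1"
  by (induction A rule: infinite_finite_induct) (simp_all add: mult_single)

lemma monomial_eq:
  fixes m :: "'n::finite \<Rightarrow>\<^sub>0 nat"
  shows "Poly_Mapping.single m c = Const c * (\<Prod>i\<in>UNIV. Var i ^ Poly_Mapping.lookup m i)"
proof -
  have "(\<Sum>i\<in>UNIV. Poly_Mapping.single i (Poly_Mapping.lookup m i)) = m"
    by (rule poly_mapping_eqI) (simp add: lookup_sum lookup_single when_def)
  then show ?thesis
    by (simp add: Var_power prod_single_one Const_def mult_single)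
qed

text \<open>Constants and variables generate the polynomial ring, so facts about substitutions,
  which are ring homomorphisms, need checking on these only.\<close>

lemma mpoly_ring_induct [case_names Const Var add mult]:
  fixes f :: "'n::finite mpoly"
  assumes Const: "\<And>c. P (Const c)" and Var: "\<And>i. P (Var i)"
    and add: "\<And>f g. P f \<Longrightarrow> P g \<Longrightarrow> P (f + g)"
    and mult: "\<And>f g. P f \<Longrightarrow> P g \<Longrightarrow> P (f * g)"
  shows "P f"
proof (induction f rule: mpoly_induct)
  case (single m c)
  have 1: "P 1" using Const[of 1] by simp
  have pow: "P (Var i ^ k)" for i k
    by (induction k) (simp_all add: 1 Var mult)
  have "P (\<Prod>i\<in>A. Var i ^ Poly_Mapping.lookup m i)" for A
    by (induction A rule: infinite_finite_induct) (simp_all add: 1 pow mult)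
  then show ?case
    unfolding monomial_eq by (intro mult Const)
qed (rule add)

lemma poly_subst_superset:
  assumes "finite K" "Poly_Mapping.keys f \<subseteq> K"
  shows "poly_subst h f =
    (\<Sum>m\<in>K. Const (Poly_Mapping.lookup f m) * (\<Prod>i\<in>UNIV. h i ^ Poly_Mapping.lookup m i))"
  unfolding poly_subst_def using assms
  by (intro sum.mono_neutral_left) (auto simp: in_keys_iff)

lemma poly_subst_add: "poly_subst h (f + g) = poly_subst h f + poly_subst h g"
proof -
  let ?K = "Poly_Mapping.keys f \<union> Poly_Mapping.keys g"
  have "Poly_Mapping.keys (f + g) \<subseteq> ?K"
    by (rule Poly_Mapping.keys_add)
  then show ?thesis
    by (simp add: poly_subst_superset[of ?K] lookup_add distrib_right sum.distrib Const_add)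
qed

lemma poly_subst_single:
  "poly_subst h (Poly_Mapping.single m c) = Const c * (\<Prod>i\<in>UNIV. h i ^ Poly_Mapping.lookup m i)"
  by (simp add: poly_subst_superset[of "{m}"])

lemma poly_subst_mult: "poly_subst h (f * g) = poly_subst h f * poly_subst h g"
proof (induction f rule: mpoly_induct)
  case (single m c)
  show ?case
  proof (induction g rule: mpoly_induct)
    case (single l d)
    show ?case
      by (simp add: mult_single poly_subst_single lookup_add power_add prod.distrib Const_mult)
  next
    case (add g1 g2)
    then show ?case
      by (simp add: distrib_left poly_subst_add)
  qed
next
  case (add f1 f2)
  then show ?case
    by (simp add: distrib_right poly_subst_add)
qed

lemma poly_subst_Const [simp]: "poly_subst h (Const c) = Const c"
  by (subst Const_def, subst poly_subst_single) simp

lemma poly_subst_0 [simp]: "poly_subst h 0 = 0"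
  by (simp add: poly_subst_def)

lemma poly_subst_1 [simp]: "poly_subst h 1 = 1"
  using poly_subst_Const[of h 1] by simp

lemma poly_subst_Var [simp]: "poly_subst h (Var i) = h i"
proof -
  have "(\<Prod>j\<in>UNIV. h j ^ Poly_Mapping.lookup (Poly_Mapping.single i (1::nat)) j) =
        (\<Prod>j\<in>UNIV. if j = i then h j else 1)"
    by (intro prod.cong) (auto simp: lookup_single when_def)
  then show ?thesis
    by (simp add: Var_def poly_subst_single)
qed

lemma poly_subst_uminus: "poly_subst h (- f) = - poly_subst h f"
  by (metis add_eq_0_iff poly_subst_0 poly_subst_add)

lemma poly_subst_sum: "poly_subst h (\<Sum>x\<in>A. f x) = (\<Sum>x\<in>A. poly_subst h (f x))"
  by (induction A rule: infinite_finite_induct) (simp_all add: poly_subst_add)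

lemma poly_subst_power: "poly_subst h (f ^ k) = poly_subst h f ^ k"
  by (induction k) (simp_all add: poly_subst_mult)

lemma poly_subst_linear_poly:
  "poly_subst h (linear_poly a) = (\<Sum>i\<in>UNIV. Const (a $ i) * h i)"
  by (simp add: linear_poly_def poly_subst_sum poly_subst_mult)

lemma poly_act_mult: "poly_act g (f1 * f2) = poly_act g f1 * poly_act g f2"
  by (simp add: poly_act_def poly_subst_mult)

lemma poly_act_sum: "poly_act g (\<Sum>x\<in>A. f x) = (\<Sum>x\<in>A. poly_act g (f x))"
  by (simp add: poly_act_def poly_subst_sum)

lemma poly_act_Const [simp]: "poly_act g (Const c) = Const c"
  by (simp add: poly_act_def)

text \<open>A composite of substitutions is a ring homomorphism fixing the constants, so its values
  on the variables determine it.\<close>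

lemma poly_subst_comp_eqI:
  assumes "\<And>i. poly_subst k (h i) = l i"
  shows "poly_subst k (poly_subst h f) = poly_subst l f"
  by (induction f rule: mpoly_ring_induct) (simp_all add: assms poly_subst_add poly_subst_mult)

text \<open>Modulo \<open>d\<close> the substitution is the identity on the variables, hence on
  everything they generate.\<close>

lemma dvd_diff_poly_subst:
  assumes "\<And>i. d dvd Var i - h i"
  shows "d dvd f - poly_subst h f"
proof (induction f rule: mpoly_ring_induct)
  case (add f g)
  then have "d dvd (f - poly_subst h f) + (g - poly_subst h g)" by (rule dvd_add)
  then show ?case by (simp add: poly_subst_add algebra_simps)
next
  case (mult f g)
  then have "d dvd f * (g - poly_subst h g) + (f - poly_subst h f) * poly_subst h g"
    by (intro dvd_add dvd_mult dvd_mult2)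
  then show ?case by (simp add: poly_subst_mult algebra_simps)
qed (simp_all add: assms)

section \<open>Linear forms as polynomials\<close>

lemma linear_poly_add: "linear_poly (a + b) = linear_poly a + linear_poly b"
  by (simp add: linear_poly_def Const_add distrib_right sum.distrib)

lemma linear_poly_scale: "linear_poly (c *s a) = Const c * linear_poly a"
  by (simp add: linear_poly_def Const_mult sum_distrib_left mult.assoc)

lemma linear_poly_axis: "linear_poly (axis i 1) = Var i"
proof -
  have "linear_poly (axis i 1) = (\<Sum>j\<in>UNIV. if j = i then Var j else 0)"
    unfolding linear_poly_def by (intro sum.cong) (auto simp: axis_def)
  then show ?thesis by simp
qed

section \<open>Rank-one perturbations\<close>

text \<open>The outer product of a column \<open>c\<close> and a row \<open>a\<close>. Inverses of
  reflections take the shape \<open>mat 1 + rank_one c a\<close>, with \<open>a\<close> the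
  coefficients of a form defining the hyperplane.\<close>

definition rank_one :: "('a::semiring_1 ^ 'n) \<Rightarrow> ('a ^ 'm) \<Rightarrow> 'a ^ 'm ^ 'n" where
  "rank_one c a = (\<chi> i j. c $ i * a $ j)"

text \<open>The matrix determinant lemma. In coordinates where the form \<open>a\<close> is a
  coordinate function, the matrix differs from the identity in one column only, and its determinant
  is the diagonal entry there.\<close>

lemma det_mat_1_add_rank_one:
  fixes a c :: "'a::field ^ 'n"
  shows "det (mat 1 + rank_one c a) = 1 + (\<Sum>i\<in>UNIV. a $ i * c $ i)"
proof (cases "a = 0")
  case True
  then have "rank_one c a = 0" by (simp add: rank_one_def vec_eq_iff)
  then show ?thesis using True by simp
next
  case False
  then obtain j where j: "a $ j \<noteq> 0" by (auto simp: vec_eq_iff)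
  let ?mu = "1 + (\<Sum>i\<in>UNIV. a $ i * c $ i)"
  \<comment> \<open>\<open>P\<close> conjugates the rank-one perturbation to the identity with its \<open>j\<close>-th column replaced by \<open>w\<close>.\<close>
  define P :: "'a ^ 'n ^ 'n" where "P = (\<chi> i. if i = j then a else axis i 1)"
  \<comment> \<open>This is \<open>P *v c\<close> plus the \<open>j\<close>-th unit vector.\<close>
  define w :: "'a ^ 'n" where "w = (\<chi> i. if i = j then ?mu else c $ i)"
  define D :: "'a ^ 'n ^ 'n" where "D = (\<chi> i k. if k = j then w $ i else mat 1 $ i $ k)"
  have detD: "det D = ?mu"
    using cramer_lemma[of j "mat 1" w] by (simp add: D_def w_def cong: if_cong)
  have detP: "det P = a $ j"
  proof -
    have "transpose P = (\<chi> i k. if k = j then (mat 1 *v a) $ i else mat 1 $ i $ k)"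
      by (subst matrix_vector_mul_lid) (auto simp: P_def transpose_def vec_eq_iff axis_def mat_def)
    then have "det (transpose P) = a $ j * det (mat 1 :: 'a ^ 'n ^ 'n)"
      by (simp only: cramer_lemma)
    then show ?thesis by (simp add: det_transpose)
  qed
  have "P ** (mat 1 + rank_one c a) = D ** P"
  proof -
    have "(P ** (mat 1 + rank_one c a)) $ i $ k = (D ** P) $ i $ k" for i k
    proof -
      have "(D ** P) $ i $ k =
          (\<Sum>l\<in>UNIV. (if l = j then w $ i * a $ k else 0) + (if l = i then if i = j then 0 else P $ i $ k else 0))"
        unfolding matrix_matrix_mult_def vec_lambda_beta
        by (intro sum.cong) (auto simp: D_def P_def mat_def)
      then have D: "(D ** P) $ i $ k = w $ i * a $ k + (if i = j then 0 else P $ i $ k)"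
        by (simp add: sum.distrib)
      have "(P ** rank_one c a) $ i $ k = (\<Sum>l\<in>UNIV. P $ i $ l * c $ l) * a $ k"
        by (simp add: matrix_matrix_mult_def rank_one_def sum_distrib_right mult.assoc)
      moreover have "(\<Sum>l\<in>UNIV. P $ i $ l * c $ l) = c $ i" if "i \<noteq> j"
      proof -
        have "(\<Sum>l\<in>UNIV. P $ i $ l * c $ l) = (\<Sum>l\<in>UNIV. if l = i then c $ l else 0)"
          using that by (intro sum.cong) (auto simp: P_def axis_def)
        then show ?thesis by simp
      qed
      ultimately have "(P ** (mat 1 + rank_one c a)) $ i $ k =
          P $ i $ k + (if i = j then \<Sum>l\<in>UNIV. a $ l * c $ l else c $ i) * a $ k"
        by (simp add: matrix_add_ldistrib P_def)
      then show ?thesis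
        unfolding D by (simp add: w_def P_def algebra_simps)
    qed
    then show ?thesis by (simp add: vec_eq_iff)
  qed
  then have "det P * det (mat 1 + rank_one c a) = det D * det P"
    by (metis det_mul)
  with j show ?thesis by (simp add: detD detP)
qed

lemma matrix_add_rdistrib: "(A + B) ** C = A ** C + B ** C"
  by (simp add: matrix_matrix_mult_def vec_eq_iff distrib_right sum.distrib)

text \<open>The square of \<open>rank_one c a\<close> is a scalar multiple of itself, so the
  matrices \<open>mat 1 + rank_one (t *s c) a\<close> are closed under products. The new parameter
  is the recursion behind the powers of a reflection.\<close>

lemma mat_1_add_rank_one_mult: "(mat 1 + rank_one (t *s c) a) ** (mat 1 + rank_one c a) =
   mat 1 + rank_one ((1 + t * (1 + (\<Sum>i\<in>UNIV. a $ i * c $ i))) *s c) (a::'a::comm_ring_1^'n)"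
proof -
  have "rank_one (t *s c) a ** rank_one c a = rank_one ((t * (\<Sum>i\<in>UNIV. a $ i * c $ i)) *s c) a"
    by (simp add: rank_one_def matrix_matrix_mult_def vec_eq_iff sum_distrib_left sum_distrib_right mult_ac)
  then show ?thesis
    by (simp add: matrix_add_ldistrib matrix_add_rdistrib)
       (simp add: rank_one_def vec_eq_iff algebra_simps)
qed

text \<open>The map \<open>r - mat 1\<close> vanishes on the kernel of the form \<open>a\<close>,
  hence factors through that form.\<close>

lemma linear_form_factor:
  fixes r :: "'a::field ^ 'n ^ 'n"
  assumes "a \<noteq> 0" "\<And>v. (\<Sum>i\<in>UNIV. a $ i * v $ i) = 0 \<Longrightarrow> r *v v = v"
  obtains c where "r = mat 1 + rank_one c a"
proof -
  obtain j where j: "a $ j \<noteq> 0" using assms(1) by (auto simp: vec_eq_iff)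
  \<comment> \<open>The form takes the value 1 at \<open>axis j 1\<close> divided by
    \<open>a $ j\<close>; \<open>c\<close> is the displacement of that vector under
    \<open>r\<close>.\<close>
  define c where "c = inverse (a $ j) *s (r *v axis j 1 - axis j 1)"
  have "r *v v = (mat 1 + rank_one c a) *v v" for v
  proof -
    define t where "t = (\<Sum>i\<in>UNIV. a $ i * v $ i)"
    \<comment> \<open>The projection of \<open>v\<close> to the kernel along the \<open>j\<close>-th
      axis.\<close>
    define u where "u = v - (t / a $ j) *s axis j 1"
    have ax: "(\<Sum>i\<in>UNIV. a $ i * axis j 1 $ i) = a $ j"
      by (simp add: axis_def if_distrib[of "\<lambda>x. a $ _ * x"] cong: if_cong)
    have "(\<Sum>i\<in>UNIV. a $ i * u $ i) = t - (t / a $ j) * (\<Sum>i\<in>UNIV. a $ i * axis j 1 $ i)"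
      by (simp add: u_def right_diff_distrib sum_subtractf sum_distrib_left mult_ac flip: t_def)
    then have "(\<Sum>i\<in>UNIV. a $ i * u $ i) = 0" using j ax by simp
    then have u: "r *v u = u" by (rule assms(2))
    have v: "v = u + (t / a $ j) *s axis j 1" by (simp add: u_def)
    have "r *v v = u + (t / a $ j) *s (r *v axis j 1)"
      by (subst v) (simp only: matrix_vector_right_distrib vec.scale u)
    also have "\<dots> = v + t *s c"
      by (simp add: c_def u_def vec_eq_iff field_simps)
    also have "\<dots> = (mat 1 + rank_one c a) *v v"
      by (simp add: matrix_vector_mult_add_rdistrib)
         (simp add: rank_one_def matrix_vector_mult_def vec_eq_iff t_def sum_distrib_left mult_ac)
    finally show ?thesis .
  qed
  then have "r = mat 1 + rank_one c a"
    by (simp add: matrix_eq)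
  then show ?thesis by (rule that)
qed

section \<open>Exterior algebra\<close>

lemma wedge_add_left: "wedge (x + y) z = wedge x z + wedge y z"
  by (simp add: wedge_def vec_eq_iff algebra_simps sum.distrib)

lemma wedge_add_right: "wedge x (y + z) = wedge x y + wedge x z"
  by (simp add: wedge_def vec_eq_iff algebra_simps sum.distrib)

lemma wedge_scale_left: "wedge (c *s x) y = c *s wedge x y"
  by (simp add: wedge_def vec_eq_iff sum_distrib_left mult_ac)

lemma wedge_scale_right: "wedge x (c *s y) = c *s wedge x y"
  by (simp add: wedge_def vec_eq_iff sum_distrib_left mult_ac)

lemma wedge_zero_left [simp]: "wedge 0 y = 0"
  by (simp add: wedge_def vec_eq_iff)

lemma wedge_zero_right [simp]: "wedge x 0 = 0"
  by (simp add: wedge_def vec_eq_iff)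

lemma wedge_sum_left: "wedge (\<Sum>x\<in>A. f x) y = (\<Sum>x\<in>A. wedge (f x) y)"
  by (induction A rule: infinite_finite_induct) (simp_all add: wedge_add_left)

lemma wedge_sum_right: "wedge x (\<Sum>y\<in>A. f y) = (\<Sum>y\<in>A. wedge x (f y))"
  by (induction A rule: infinite_finite_induct) (simp_all add: wedge_add_right)

text \<open>The basis forms span, so identities linear in each argument reduce to them.\<close>

lemma form_induct [case_names axis add scale]:
  fixes w :: "('n::finite, 'a::comm_ring_1) form"
  assumes axis: "\<And>I. P (axis I 1)" and add: "\<And>x y. P x \<Longrightarrow> P y \<Longrightarrow> P (x + y)"
    and scale: "\<And>c x. P x \<Longrightarrow> P (c *s x)"
  shows "P w"
proof -
  have "P 0" using scale[OF axis, of 0] by simp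
  then have "P (\<Sum>I\<in>A. w $ I *s axis I 1)" for A
    by (induction A rule: infinite_finite_induct) (simp_all add: axis add scale)
  then show ?thesis by (metis basis_expansion)
qed

section \<open>Signs and associativity of the wedge product\<close>

lemma wedge_axis_not_disjoint:
  assumes "I \<inter> J \<noteq> {}"
  shows "wedge (axis I 1) (axis J (1::'a::comm_ring_1)) = 0"
proof -
  have "shuffle_sign L (K - L) * axis I (1::'a) $ L * axis J 1 $ (K - L) = 0" for K L
    using assms by (auto simp: axis_def)
  then show ?thesis
    unfolding wedge_def by (simp add: vec_eq_iff)
qed

text \<open>The inversions against \<open>K\<close> split according to whether the first index lies
  in \<open>I\<close> or in \<open>J\<close>.\<close>

lemma shuffle_sign_Un_left:
  fixes I J K :: "'n::{finite,linorder} set"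
  assumes "I \<inter> J = {}"
  shows "(shuffle_sign (I \<union> J) K :: 'a::comm_ring_1) = shuffle_sign I K * shuffle_sign J K"
proof -
  let ?S = "\<lambda>I. {(i, k). i \<in> I \<and> k \<in> K \<and> k < i}"
  have "?S (I \<union> J) = ?S I \<union> ?S J" "?S I \<inter> ?S J = {}"
    using assms by auto
  then show ?thesis
    by (simp add: shuffle_sign_def card_Un_disjoint power_add)
qed

lemma shuffle_sign_Un_right:
  fixes I J K :: "'n::{finite,linorder} set"
  assumes "J \<inter> K = {}"
  shows "(shuffle_sign I (J \<union> K) :: 'a::comm_ring_1) = shuffle_sign I J * shuffle_sign I K"
proof -
  let ?S = "\<lambda>J. {(i, j). i \<in> I \<and> j \<in> J \<and> j < i}"
  have "?S (J \<union> K) = ?S J \<union> ?S K" "?S J \<inter> ?S K = {}"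
    using assms by auto
  then show ?thesis
    by (simp add: shuffle_sign_def card_Un_disjoint power_add)
qed

text \<open>For pairwise disjoint sets both sides carry the product of the three pairwise signs; any
  overlap makes both sides vanish.\<close>

lemma wedge_assoc_axis:
  "wedge (wedge (axis I 1) (axis J 1)) (axis K (1::'a::comm_ring_1)) =
   wedge (axis I 1) (wedge (axis J 1) (axis K 1))"
proof (cases "I \<inter> J = {} \<and> I \<inter> K = {} \<and> J \<inter> K = {}")
  case True
  then have "(I \<union> J) \<inter> K = {}" "I \<inter> (J \<union> K) = {}" by auto
  then show ?thesis using True
    by (simp add: wedge_axis wedge_scale_left wedge_scale_right shuffle_sign_Un_left 
      shuffle_sign_Un_right Un_assoc vector_smult_assoc mult_ac)
next
  case False
  then consider "I \<inter> J \<noteq> {}" | "I \<inter> J = {}" "J \<inter> K \<noteq> {}"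
    | "I \<inter> J = {}" "J \<inter> K = {}" "I \<inter> K \<noteq> {}" by blast
  then show ?thesis
  proof cases
    case 1
    then have "I \<inter> (J \<union> K) \<noteq> {}" by auto
    with 1 show ?thesis
      by (cases "J \<inter> K = {}") (simp_all add: wedge_axis wedge_axis_not_disjoint wedge_scale_right)
  next
    case 2
    then have "(I \<union> J) \<inter> K \<noteq> {}" by auto
    with 2 show ?thesis
      by (simp add: wedge_axis wedge_axis_not_disjoint wedge_scale_left)
  next
    case 3
    then have "(I \<union> J) \<inter> K \<noteq> {}" "I \<inter> (J \<union> K) \<noteq> {}" by auto
    with 3 show ?thesis
      by (simp add: wedge_axis wedge_axis_not_disjoint wedge_scale_left wedge_scale_right)
  qed
qed

lemma wedge_assoc: "wedge (wedge x y) z = wedge x (wedge y z)"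
proof (induction x rule: form_induct)
  case (axis I)
  show ?case
  proof (induction y rule: form_induct)
    case (axis J)
    show ?case
      by (induction z rule: form_induct)
        (simp_all add: wedge_assoc_axis wedge_add_right wedge_scale_right)
  qed (simp_all add: wedge_add_left wedge_scale_left wedge_add_right wedge_scale_right)
qed (simp_all add: wedge_add_left wedge_scale_left)

text \<open>This sign allows graded commutativity to be stated for forms of mixed degree.\<close>

definition grade_involution :: "('n::finite, 'a::comm_ring_1) form \<Rightarrow> ('n, 'a) form" where
  "grade_involution w = (\<chi> I. (- 1) ^ card I * w $ I)"

lemma grade_involution_add: "grade_involution (x + y) = grade_involution x + grade_involution y"
  by (simp add: grade_involution_def vec_eq_iff distrib_left)

lemma grade_involution_scale: "grade_involution (c *s x) = c *s grade_involution x"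
  by (simp add: grade_involution_def vec_eq_iff mult_ac)

lemma one_form_expansion:
  fixes x :: "('n::finite, 'a::semiring_1) form"
  assumes "x \<in> homogeneous_forms 1"
  shows "x = (\<Sum>i\<in>UNIV. x $ {i} *s axis {i} 1)"
proof -
  have "x $ I = (\<Sum>i\<in>UNIV. x $ {i} *s axis {i} 1) $ I" for I
  proof (cases "card I = 1")
    case True
    then obtain j where I: "I = {j}" by (auto simp: card_1_singleton_iff)
    have "(\<Sum>i\<in>UNIV. x $ {i} *s axis {i} 1) $ I = (\<Sum>i\<in>UNIV. if i = j then x $ {i} else 0)"
      unfolding sum_component by (intro sum.cong) (auto simp: I axis_def)
    then show ?thesis by (simp add: I)
  next
    case False
    then have "(axis {i} 1 :: ('n, 'a) form) $ I = 0" for i by (auto simp: axis_def)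
    with False assms show ?thesis
      by (simp add: homogeneous_forms_def)
  qed
  then show ?thesis unfolding vec_eq_iff by blast
qed

text \<open>By linearity \<open>x\<close> is a single \<open>dx_i\<close> and \<open>y\<close> a
  basis form on \<open>J\<close>. If \<open>i\<close> is not in \<open>J\<close>, the inversions in
  the two orders together count each element of \<open>J\<close> once.\<close>

lemma wedge_one_form_commute:
  fixes x y :: "('n::{finite,linorder}, 'a::comm_ring_1) form"
  assumes "x \<in> homogeneous_forms 1"
  shows "wedge x y = wedge (grade_involution y) x"
proof -
  have gi: "grade_involution (axis I 1) = (- 1) ^ card I *s (axis I 1 :: ('n, 'a) form)" for I
    by (auto simp: grade_involution_def vec_eq_iff axis_def)
  have swap: "wedge (axis {i} 1) (axis J 1) = (-1) ^ card J *s wedge (axis J 1) (axis {i} 1 :: ('n, 'a) form)" for i J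
  proof (cases "i \<in> J")
    case True
    then show ?thesis by (simp add: wedge_axis_not_disjoint)
  next
    case False
    have "card {(k, j). k \<in> {i} \<and> j \<in> J \<and> j < k} = card {j \<in> J. j < i}"
      by (rule bij_betw_same_card[of snd]) (auto simp: bij_betw_def inj_on_def image_iff)
    moreover have "card {(k, j). k \<in> J \<and> j \<in> {i} \<and> j < k} = card {j \<in> J. i < j}"
      by (rule bij_betw_same_card[of fst]) (auto simp: bij_betw_def inj_on_def image_iff)
    moreover have "card J = card {j \<in> J. j < i} + card {j \<in> J. i < j}"
      using False by (subst card_Un_disjoint[symmetric]) (auto intro!: arg_cong[of _ _ card] simp: not_less_iff_gr_or_eq)
    \<comment> \<open>The sign from the elements above \<open>i\<close> occurs twice on the right
      and cancels.\<close>
    ultimately have "(shuffle_sign {i} J :: 'a) = (- 1) ^ card J * shuffle_sign J {i}"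
      by (simp add: shuffle_sign_def power_add mult.assoc flip: power_mult_distrib)
    with False show ?thesis
      by (simp add: wedge_axis vector_smult_assoc)
  qed
  have "wedge (axis {i} 1) y = wedge (grade_involution y) (axis {i} 1)" for i
    by (induction y rule: form_induct)
       (simp_all add: gi swap wedge_add_left wedge_add_right wedge_scale_left wedge_scale_right
         grade_involution_add grade_involution_scale)
  then show ?thesis
    by (subst (1 2) one_form_expansion[OF assms])
       (simp add: wedge_sum_left wedge_sum_right wedge_scale_left wedge_scale_right)
qed

text \<open>Graded commutativity makes the square its own negative, which forces 0 in characteristic
  0.\<close>

lemma wedge_one_form_self:
  fixes x :: "('n::{finite,linorder}, 'a::{idom,ring_char_0}) form"
  assumes "x \<in> homogeneous_forms 1"
  shows "wedge x x = 0"
proof -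
  have "grade_involution x = - 1 *s x"
  proof -
    have "(- 1) ^ card I * x $ I = - (x $ I)" for I
      using assms by (cases "card I = 1") (auto simp: homogeneous_forms_def)
    then show ?thesis by (simp add: grade_involution_def vec_eq_iff)
  qed
  then have "wedge x x = - 1 *s wedge x x"
    using wedge_one_form_commute[OF assms, of x] by (metis wedge_scale_left)
  then have "wedge x x $ I = - (wedge x x $ I)" for I
    by (metis mult_minus1 vector_smult_component)
  then show ?thesis by (simp add: vec_eq_iff)
qed

section \<open>Differentials of linear forms\<close>

lemma partial_deriv_superset:
  assumes "finite K" "Poly_Mapping.keys f \<subseteq> K"
  shows "partial_deriv i f = (\<Sum>m\<in>K. Poly_Mapping.single (m - Poly_Mapping.single i 1)
    (of_nat (Poly_Mapping.lookup m i) * Poly_Mapping.lookup f m))"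
  unfolding partial_deriv_def using assms
  by (intro sum.mono_neutral_left) (auto simp: in_keys_iff)

lemma partial_deriv_add: "partial_deriv i (f + g) = partial_deriv i f + partial_deriv i g"
proof -
  let ?K = "Poly_Mapping.keys f \<union> Poly_Mapping.keys g"
  have "Poly_Mapping.keys (f + g) \<subseteq> ?K"
    by (rule Poly_Mapping.keys_add)
  then show ?thesis
    by (simp add: partial_deriv_superset[of ?K] lookup_add distrib_left sum.distrib single_add)
qed

lemma partial_deriv_single:
  "partial_deriv i (Poly_Mapping.single m c) =
     Poly_Mapping.single (m - Poly_Mapping.single i 1) (of_nat (Poly_Mapping.lookup m i) * c)"
  by (simp add: partial_deriv_superset[of "{m}"])

lemma partial_deriv_linear_poly: "partial_deriv i (linear_poly a) = Const (a $ i)"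
proof -
  have "partial_deriv i (\<Sum>j\<in>A. Const (a $ j) * Var j) =
      (\<Sum>j\<in>A. if j = i then Const (a $ j) else 0)" for A
  proof (induction A rule: infinite_finite_induct)
    case (insert j A)
    have "partial_deriv i (Const (a $ j) * Var j) = (if j = i then Const (a $ j) else 0)"
      by (simp add: Const_def Var_def mult_single partial_deriv_single lookup_single)
    with insert show ?case by (auto simp: partial_deriv_add)
  qed (simp_all add: partial_deriv_def)
  then show ?thesis by (simp add: linear_poly_def)
qed

lemma differential_linear_poly:
  "differential (linear_poly a) = (\<Sum>i\<in>UNIV. Const (a $ i) *s axis {i} 1)"
  by (simp add: differential_def partial_deriv_linear_poly)

lemma differential_linear_poly_homogeneous:
  "differential (linear_poly a) \<in> homogeneous_forms 1"
  by (auto simp: differential_linear_poly homogeneous_forms_def axis_def intro!: sum.neutral)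

text \<open>Constants are fixed by \<open>poly_act g\<close>, so the action on coefficients commutes
  with wedging by such a differential.\<close>

lemma differential_linear_poly_constant: "\<exists>d. differential (linear_poly a) $ I = Const d"
proof -
  have "differential (linear_poly a) $ I = Const (\<Sum>i\<in>UNIV. a $ i * (if I = {i} then 1 else 0))"
    unfolding Const_sum Const_mult
    by (auto simp: differential_linear_poly axis_def intro!: sum.cong)
  then show ?thesis ..
qed

text \<open>The argument has the shape of the \<open>i\<close>-th row of
  \<open>mat 1 + rank_one c a\<close>, so this computes \<open>g dx_i\<close> for a reflection
  \<open>g\<close>.\<close>

lemma differential_linear_poly_add_scale:
  "differential (linear_poly (axis i 1 + c *s a)) = axis {i} 1 + Const c *s differential (linear_poly a)"
proof -
  have "differential (linear_poly (axis i 1)) = (\<Sum>j\<in>UNIV. if j = i then axis {j} 1 else 0)"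
    unfolding differential_linear_poly by (intro sum.cong) (auto simp: axis_def)
  moreover have "differential (linear_poly (x + y)) =
      differential (linear_poly x) + differential (linear_poly y)" for x y :: "'a cvec"
    by (simp add: differential_linear_poly Const_add vector_sadd_rdistrib sum.distrib)
  moreover have "differential (linear_poly (c *s a)) = Const c *s differential (linear_poly a)"
    by (simp add: differential_linear_poly Const_mult vec_eq_iff sum_distrib_left mult.assoc)
  ultimately show ?thesis by simp
qed

text \<open>In the expanded product, a factor \<open>t\<close> coming from a shift moves past the
  others, up to sign, until it meets the final \<open>t\<close> and gives 0.\<close>

lemma wedge_list_shift:
  fixes t :: "('n::{finite,linorder}, 'a::comm_ring_1) form"
  assumes "t \<in> homogeneous_forms 1" "wedge t t = 0"
  shows "wedge (wedge_list (map (\<lambda>i. f i + c i *s t) xs)) t = wedge (wedge_list (map f xs)) t"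
proof (induction xs)
  case (Cons x xs)
  let ?W = "wedge_list (map (\<lambda>i. f i + c i *s t) xs)"
  have "wedge t (wedge ?W t) = 0"
    using assms by (metis wedge_assoc wedge_one_form_commute wedge_zero_right)
  with Cons show ?case
    by (simp add: wedge_list_def wedge_assoc wedge_add_left wedge_scale_left)
qed (simp add: wedge_list_def)

lemma wedge_homogeneous:
  assumes "x \<in> homogeneous_forms p" "y \<in> homogeneous_forms q"
  shows "wedge x y \<in> homogeneous_forms (p + q)"
proof -
  have "shuffle_sign I (K - I) * x $ I * y $ (K - I) = 0" if "card K \<noteq> p + q" "I \<subseteq> K" for K I
  proof -
    have "card K = card I + card (K - I)"
      using that by (metis card_Diff_subset card_mono finite le_add_diff_inverse)
    with that have "card I \<noteq> p \<or> card (K - I) \<noteq> q" by auto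
    with assms show ?thesis by (auto simp: homogeneous_forms_def)
  qed
  then show ?thesis
    by (auto simp: homogeneous_forms_def wedge_def intro!: sum.neutral)
qed

lemma row_mat_1_add_rank_one: "row i (mat 1 + rank_one c a) = axis i 1 + c $ i *s a"
  by (auto simp: row_def rank_one_def mat_def axis_def vec_eq_iff)

lemma poly_act_minus_one_power: "poly_act g ((- 1) ^ k) = (- 1) ^ k"
  by (simp add: poly_act_def poly_subst_power poly_subst_uminus)

text \<open>Each \<open>g dx_i\<close> is \<open>dx_i\<close> plus a multiple of \<open>t\<close>,
  and wedging with \<open>t\<close> removes these multiples. What remains is the action on the
  coefficients of \<open>w\<close>; it can be taken outside since the signs and the coefficients of
  \<open>t\<close> are constants.\<close>

lemma wedge_form_act:
  fixes w :: "('n::{finite,linorder}, 'n mpoly) form"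
  assumes "matrix_inv g = mat 1 + rank_one c a"
  defines "t \<equiv> differential (linear_poly a)"
  shows "wedge (form_act g w) t = (\<chi> K. poly_act g (wedge w t $ K))"
proof -
  have t1: "t \<in> homogeneous_forms 1"
    unfolding t_def by (rule differential_linear_poly_homogeneous)
  have dact: "differential (poly_act g (Var i)) = axis {i} 1 + Const (c $ i) *s t" for i
    by (simp add: poly_act_def assms(1) row_mat_1_add_rank_one differential_linear_poly_add_scale t_def)
  have "wedge t t = 0" using t1
    by (rule wedge_one_form_self)
  with t1 have "wedge (wedge_list (map (\<lambda>i. differential (poly_act g (Var i))) (sorted_list_of_set I))) t =
      wedge (axis I 1) t" for I
    unfolding dact by (simp add: wedge_list_shift wedge_list_dx)
  then have "wedge (form_act g w) t = (\<Sum>I\<in>UNIV. poly_act g (w $ I) *s wedge (axis I 1) t)"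
    by (simp add: form_act_def wedge_sum_left wedge_scale_left)
  also have "\<dots> = wedge (\<Sum>I\<in>UNIV. (\<chi> I. poly_act g (w $ I)) $ I *s axis I 1) t"
    by (simp add: wedge_sum_left wedge_scale_left)
  also have "\<dots> = wedge (\<chi> I. poly_act g (w $ I)) t"
    by (simp only: basis_expansion)
  also have "\<dots> = (\<chi> K. poly_act g (wedge w t $ K))"
  proof -
    have "poly_act g (t $ J) = t $ J" for J
      using differential_linear_poly_constant[of a J] by (auto simp: t_def)
    then show ?thesis
      by (simp add: wedge_def poly_act_sum poly_act_mult shuffle_sign_def poly_act_minus_one_power)
  qed
  finally show ?thesis .
qed

section \<open>Divisibility by a linear form\<close>

lemma linear_poly_eq_0_iff [simp]: "linear_poly a = 0 \<longleftrightarrow> a = 0"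
  by (metis Const_eq_0_iff linear_poly_scale mult_zero_left partial_deriv_linear_poly vec_eq_iff
   vector_smult_lzero zero_index)

text \<open>Each variable \<open>x_i\<close> is replaced by itself plus \<open>c $ i\<close> times
  the form. The eigenvalue is the determinant of \<open>matrix_inv g\<close>.\<close>

lemma poly_act_linear_poly:
  assumes "matrix_inv g = mat 1 + rank_one c a"
  shows "poly_act g (linear_poly a) = Const (1 + (\<Sum>i\<in>UNIV. a $ i * c $ i)) * linear_poly a"
proof -
  have sum: "(\<Sum>i\<in>UNIV. Const (a $ i) * Var i) = linear_poly a"
    by (simp add: linear_poly_def)
  have "poly_act g (linear_poly a) =
      (\<Sum>i\<in>UNIV. Const (a $ i) * Var i + Const (a $ i * c $ i) * linear_poly a)"
    by (simp add: poly_act_def poly_subst_linear_poly assms row_mat_1_add_rank_one linear_poly_add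
        linear_poly_scale linear_poly_axis distrib_left Const_mult mult.assoc)
  also have "\<dots> = Const (1 + (\<Sum>i\<in>UNIV. a $ i * c $ i)) * linear_poly a"
    by (simp add: sum.distrib sum Const_add Const_sum distrib_right sum_distrib_right)
  finally show ?thesis .
qed

text \<open>Restricted to the hyperplane, \<open>g\<close> acts trivially, so the equation becomes
  \<open>f = m f\<close> there and \<open>f\<close> vanishes on it.\<close>

lemma linear_poly_dvd_of_poly_act:
  fixes f :: "'n::{finite,linorder} mpoly"
  assumes "matrix_inv g = mat 1 + rank_one c a" "a \<noteq> 0"
    and "poly_act g f = Const m * f" "m \<noteq> 1"
  shows "linear_poly a dvd f"
proof -
  obtain j where j: "a $ j \<noteq> 0" using assms(2) by (auto simp: vec_eq_iff)
  \<comment> \<open>\<open>h\<close> is the projection onto the kernel of the linear form along the \<open>j\<close>-th coordinate axis.\<close>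
  define h where "h i = Var i - (if i = j then Const (inverse (a $ j)) * linear_poly a else 0)" for i
  have "poly_subst h (linear_poly a) =
      (\<Sum>i\<in>UNIV. Const (a $ i) * Var i - (if i = j then Const (a $ i) * Const (inverse (a $ j)) * linear_poly a else 0))"
    unfolding poly_subst_linear_poly by (intro sum.cong) (auto simp: h_def algebra_simps)
  also have "\<dots> = linear_poly a - Const (a $ j * inverse (a $ j)) * linear_poly a"
    by (simp add: sum_subtractf linear_poly_def Const_mult)
  finally have "poly_subst h (linear_poly a) = 0"
    using j by simp
  \<comment> \<open>The action changes each variable by a multiple of the form, which
    \<open>h\<close> sends to 0.\<close>
  then have "poly_subst h (poly_act g f) = poly_subst h f"
    unfolding poly_act_def assms(1)
    by (intro poly_subst_comp_eqI)
      (simp add: row_mat_1_add_rank_one linear_poly_add linear_poly_scale linear_poly_axis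
        poly_subst_add poly_subst_mult)
  then have "(Const m - 1) * poly_subst h f = 0"
    by (simp add: assms(3) poly_subst_mult algebra_simps)
  then have "poly_subst h f = 0"
    using assms(4) by simp
  moreover have "linear_poly a dvd f - poly_subst h f"
    by (rule dvd_diff_poly_subst) (simp add: h_def)
  ultimately show ?thesis by simp
qed

text \<open>Dividing \<open>f\<close> by the form, an eigenvector for \<open>m\<close>, lowers the
  eigenvalue from \<open>m ^ Suc k\<close> to \<open>m ^ k\<close>. The bound on \<open>j\<close>
  keeps every eigenvalue met before the last step different from 1.\<close>

lemma linear_poly_power_dvd_of_poly_act:
  fixes f :: "'n::{finite,linorder} mpoly"
  assumes "matrix_inv g = mat 1 + rank_one c a" "a \<noteq> 0"
  defines "m \<equiv> 1 + (\<Sum>i\<in>UNIV. a $ i * c $ i)"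
  assumes "m \<noteq> 0" "\<And>j. 0 < j \<Longrightarrow> j \<le> k \<Longrightarrow> m ^ j \<noteq> 1"
    and "poly_act g f = Const (m ^ k) * f"
  shows "linear_poly a ^ k dvd f"
  using assms(5,6)
proof (induction k arbitrary: f)
  case (Suc k)
  have "linear_poly a dvd f"
    using linear_poly_dvd_of_poly_act[OF assms(1,2) Suc.prems(2)] Suc.prems(1)[of "Suc k"] by blast
  then obtain f' where f': "f = linear_poly a * f'" ..
  have "Const m * linear_poly a * poly_act g f' = Const m * linear_poly a * (Const (m ^ k) * f')"
    using Suc.prems(2) unfolding f' poly_act_mult poly_act_linear_poly[OF assms(1)] m_def[symmetric]
    by (simp add: Const_mult mult_ac)
  then have "poly_act g f' = Const (m ^ k) * f'"
    using assms(2,4) by simp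
  then have "linear_poly a ^ k dvd f'"
    using Suc by simp
  then show ?case by (simp add: f' mult_dvd_mono)
qed simp

section \<open>The generator of a pointwise stabilizer\<close>

text \<open>One more factor turns the parameter \<open>t\<close> into \<open>1 + t * m\<close>, with
  \<open>m\<close> the eigenvalue; iteration from 0 gives a geometric sum.\<close>

lemma mat_1_add_rank_one_pow:
  fixes a c :: "('n::finite) cvec"
  assumes "r = mat 1 + rank_one c a"
  shows "r [^]\<^bsub>unitary_group\<^esub> (k::nat) =
    mat 1 + rank_one ((\<Sum>j<k. (1 + (\<Sum>i\<in>UNIV. a $ i * c $ i)) ^ j) *s c) a"
proof (induction k)
  case 0
  show ?case by (simp add: unitary_group_def rank_one_def vec_eq_iff)
next
  case (Suc k)
  let ?m = "1 + (\<Sum>i\<in>UNIV. a $ i * c $ i)"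
  have "(\<Sum>j<Suc k. ?m ^ j) = 1 + (\<Sum>j<k. ?m ^ j) * ?m"
    by (simp add: sum.lessThan_Suc_shift sum_distrib_left mult.commute[of _ ?m] del: sum.lessThan_Suc)
  then show ?case
    using mat_1_add_rank_one_mult[of "\<Sum>j<k. ?m ^ j" c a] Suc
    by (simp add: unitary_group_def assms del: sum.lessThan_Suc)
qed

lemma det_nat_pow: "det (r [^]\<^bsub>unitary_group\<^esub> (k::nat)) = det r ^ k"
  by (induction k) (simp_all add: unitary_group_def det_mul mult.commute)

text \<open>Links the choice-based \<open>matrix_inv\<close> used by the action to the group
  inverse, for which facts on orders are available.\<close>

lemma matrix_inv_unitary:
  assumes "unitary_matrix g"
  shows "matrix_inv g = inv\<^bsub>unitary_group\<^esub> g" "matrix_inv g ** g = mat 1" "g ** matrix_inv g = mat 1"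
proof -
  interpret group "unitary_group :: 'a cmat monoid" by (rule group_unitary_group)
  have g: "g \<in> carrier unitary_group" using assms by (simp add: unitary_group_def)
  have i: "g ** inv\<^bsub>unitary_group\<^esub> g = mat 1" "inv\<^bsub>unitary_group\<^esub> g ** g = mat 1"
    using r_inv[OF g] l_inv[OF g] by (simp_all add: unitary_group_def)
  then have m: "g ** matrix_inv g = mat 1 \<and> matrix_inv g ** g = mat 1"
    unfolding matrix_inv_def by (intro someI) auto
  then show "matrix_inv g = inv\<^bsub>unitary_group\<^esub> g"
    using i by (metis matrix_mul_assoc matrix_mul_lid matrix_mul_rid)
  from m show "matrix_inv g ** g = mat 1" "g ** matrix_inv g = mat 1" by simp_all
qed

text \<open>If \<open>m ^ j = 1\<close> with \<open>m\<close> different from 1, the geometric sum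
  vanishes and the \<open>j\<close>-th power of \<open>g\<close> is the identity, against
  \<open>j < ord g\<close>. The case \<open>m = 1\<close> is a transvection.\<close>

lemma primitive_root_of_reflection:
  fixes a c :: "('n::finite) cvec"
  assumes g: "unitary_matrix g" and inv: "matrix_inv g = mat 1 + rank_one c a" and a: "a \<noteq> 0"
  defines "m \<equiv> 1 + (\<Sum>i\<in>UNIV. a $ i * c $ i)"
  assumes j: "0 < j" "j < group.ord unitary_group g"
  shows "m ^ j \<noteq> 1"
proof
  assume mj: "m ^ j = 1"
  interpret group "unitary_group :: 'n cmat monoid" by (rule group_unitary_group)
  have gc: "g \<in> carrier unitary_group" using g by (simp add: unitary_group_def)
  have pow: "matrix_inv g [^]\<^bsub>unitary_group\<^esub> k = mat 1 + rank_one ((\<Sum>j<k. m ^ j) *s c) a" for k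
    unfolding m_def by (rule mat_1_add_rank_one_pow[OF inv])
  have ord: "ord g dvd k" if "matrix_inv g [^]\<^bsub>unitary_group\<^esub> k = mat 1" for k
  proof -
    have "inv\<^bsub>unitary_group\<^esub> (g [^]\<^bsub>unitary_group\<^esub> k) = \<one>\<^bsub>unitary_group\<^esub>"
      using that gc by (simp add: matrix_inv_unitary(1)[OF g] nat_pow_inv) (simp add: unitary_group_def)
    then have "g [^]\<^bsub>unitary_group\<^esub> k = \<one>\<^bsub>unitary_group\<^esub>"
      using gc by (metis inv_one inv_inv nat_pow_closed)
    with gc show ?thesis by (simp add: pow_eq_id)
  qed
  show False
  proof (cases "m = 1")
    case False
    then have "(\<Sum>i<j. m ^ i) = 0"
      using mj by (simp add: geometric_sum)
    then have "matrix_inv g [^]\<^bsub>unitary_group\<^esub> j = mat 1"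
      by (simp add: pow) (simp add: rank_one_def vec_eq_iff)
    with ord j show False by (metis dvd_imp_le not_le)
  next
    \<comment> \<open>Here the \<open>k\<close>-th power is \<open>mat 1 + rank_one (k c) a\<close>.
      Finite order forces \<open>c = 0\<close>, so \<open>g\<close> is the identity and no
      \<open>j\<close> lies strictly between 0 and its order.\<close>
    case True
    have "matrix_inv g [^]\<^bsub>unitary_group\<^esub> ord g = mat 1"
      using gc by (simp add: matrix_inv_unitary[OF g] nat_pow_inv) (simp add: unitary_group_def)
    then have "rank_one (of_nat (ord g) *s c) a = 0"
      by (simp add: pow True)
    then have "c = 0" using a j
      by (auto simp: rank_one_def vec_eq_iff)
    then have "matrix_inv g [^]\<^bsub>unitary_group\<^esub> (1::nat) = mat 1"
      unfolding pow by (simp add: rank_one_def vec_eq_iff)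
    with ord j show False by (metis dvd_1_iff_1 less_one not_less_zero nat_dvd_1_iff_1 less_asym)
  qed
qed

section \<open>Roots of unity and values of the character\<close>

text \<open>The first \<open>n\<close> powers of \<open>m\<close> are distinct, and there are
  exactly \<open>n\<close> roots of unity to fill.\<close>

lemma power_root_of_unity:
  fixes m z :: complex
  assumes "0 < n" "m ^ n = 1" "\<And>j. 0 < j \<Longrightarrow> j < n \<Longrightarrow> m ^ j \<noteq> 1" "z ^ n = 1"
  obtains k where "k < n" "z = m ^ k"
proof -
  have m0: "m \<noteq> 0" using assms(1,2) by (auto simp: power_0_left)
  have lt: "False" if "i < k" "k < n" "m ^ i = m ^ k" for i k
  proof -
    have "m ^ i * m ^ (k - i) = m ^ k"
      using that(1) by (simp flip: power_add)
    then have "m ^ i * m ^ (k - i) = m ^ i * 1"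
      using that(3) by simp
    then have "m ^ (k - i) = 1"
      using m0 by simp
    with assms(3) that show False by (meson less_imp_diff_less zero_less_diff)
  qed
  have "inj_on (\<lambda>k. m ^ k) {..<n}"
    by (rule inj_onI) (metis lt lessThan_iff linorder_neqE_nat)
  then have "card ((\<lambda>k. m ^ k) ` {..<n}) = card {z :: complex. z ^ n = 1}"
    using assms(1) by (simp add: card_image card_roots_unity_eq)
  moreover have "(\<lambda>k. m ^ k) ` {..<n} \<subseteq> {z. z ^ n = 1}"
  proof -
    have "(m ^ k) ^ n = (m ^ n) ^ k" for k
      by (simp add: mult.commute flip: power_mult)
    then show ?thesis using assms(2) by auto
  qed
  ultimately have "(\<lambda>k. m ^ k) ` {..<n} = {z. z ^ n = 1}"
    using assms(1) by (intro card_subset_eq finite_roots_unity) auto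
  with assms(4) that show ?thesis by auto
qed

lemma mult_character_power:
  assumes "mult_character G ch" "subgroup G unitary_group" "g \<in> G"
  shows "ch (g [^]\<^bsub>unitary_group\<^esub> (k::nat)) = ch g ^ k"
proof -
  have hom: "ch (x ** y) = ch x * ch y" if "x \<in> G" "y \<in> G" for x y
    using assms(1) that by (simp add: mult_character_def hom_def unitary_group_def complex_units_def)
  have one: "mat 1 \<in> G" using subgroup.one_closed[OF assms(2)] by (simp add: unitary_group_def)
  then have "ch (mat 1) \<noteq> 0" 
    using assms(1) by (auto simp: mult_character_def hom_def unitary_group_def complex_units_def)
  with hom[OF one one] have ch1: "ch (mat 1) = 1" by simp
  have in_G: "g [^]\<^bsub>unitary_group\<^esub> k \<in> G" for k :: nat
    using subgroup.m_closed[OF assms(2)] subgroup.one_closed[OF assms(2)] assms(3)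
    by (induction k) simp_all
  show ?thesis
  proof (induction k)
    case (Suc k)
    then show ?case using hom[OF in_G[of k] assms(3)] by (simp add: unitary_group_def)
  qed (simp add: ch1 unitary_group_def)
qed

text \<open>Two powers of \<open>g\<close> coincide by the pigeonhole principle. The value 0 of
  \<open>ord\<close> stands for infinite order.\<close>

lemma ord_pos_of_finite:
  assumes "subgroup G unitary_group" "finite G" "g \<in> G"
  shows "0 < group.ord unitary_group g"
proof -
  interpret group "unitary_group :: 'a cmat monoid" by (rule group_unitary_group)
  have g: "g \<in> carrier unitary_group"
    using assms(3) subgroup.subset[OF assms(1)] by auto
  have "g [^]\<^bsub>unitary_group\<^esub> k \<in> G" for k :: nat
    using subgroup.m_closed[OF assms(1)] subgroup.one_closed[OF assms(1)] assms(3)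
    by (induction k) simp_all
  then have "finite (range (\<lambda>k::nat. g [^]\<^bsub>unitary_group\<^esub> k))"
    using assms(2) by (meson finite_subset image_subsetI)
  then obtain i j :: nat where "i \<noteq> j" "g [^]\<^bsub>unitary_group\<^esub> i = g [^]\<^bsub>unitary_group\<^esub> j"
    using finite_imageD[of "\<lambda>k::nat. g [^]\<^bsub>unitary_group\<^esub> k" UNIV] by (auto simp: inj_on_def)
  then have "\<exists>k::nat. k > 0 \<and> g [^]\<^bsub>unitary_group\<^esub> k = \<one>\<^bsub>unitary_group\<^esub>"
    by (metis g diffs0_imp_equal pow_eq_div2 neq0_conv)
  then show ?thesis
    using ord_eq_0[OF g] by auto
qed

text \<open>The \<open>LEAST\<close> in \<open>char_exponent\<close> is attained:
  \<open>ch g\<close> is a root of unity of order dividing \<open>ord g\<close>, and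
  \<open>m\<close>, the inverse of \<open>det g\<close>, is a primitive one, so \<open>ch g\<close>
  is a power of \<open>m\<close> with exponent below \<open>ord g\<close>.\<close>

lemma char_exponent_spec:
  fixes a c :: "('n::finite) cvec"
  assumes G: "subgroup G unitary_group" "finite G" and ch: "mult_character G ch" and g: "g \<in> G"
    and inv: "matrix_inv g = mat 1 + rank_one c a" and a: "a \<noteq> 0"
  defines "m \<equiv> 1 + (\<Sum>i\<in>UNIV. a $ i * c $ i)"
  shows "char_exponent ch g < group.ord unitary_group g" "ch g = m ^ char_exponent ch g" "m \<noteq> 0"
proof -
  interpret group "unitary_group :: 'n cmat monoid" by (rule group_unitary_group)
  have gc: "g \<in> carrier unitary_group" using g subgroup.subset[OF G(1)] by auto
  then have u: "unitary_matrix g" by (simp add: unitary_group_def)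
  have pos: "0 < ord g" using G g by (rule ord_pos_of_finite)
  have detr: "det (matrix_inv g) = m" by (simp add: inv det_mat_1_add_rank_one m_def)
  then have dm: "m * det g = 1"
    using matrix_inv_unitary(2)[OF u] by (metis det_mul det_I)
  then show m0: "m \<noteq> 0" by auto
  have dinv: "det g powi (- int k) = m ^ k" for k
    using inverse_unique[of "det g" m] dm by (simp add: power_int_minus mult.commute flip: power_inverse)
  have gord: "g [^]\<^bsub>unitary_group\<^esub> ord g = mat 1"
    using pow_ord_eq_1[OF gc] by (simp add: unitary_group_def del: pow_ord_eq_1)
  then have "det g ^ ord g = 1" by (metis det_nat_pow det_I)
  then have mo: "m ^ ord g = 1"
    using dm by (metis mult.right_neutral power_mult_distrib power_one)
  have "ch (mat 1) = 1" using mult_character_power[OF ch G(1) g, of 0] by (simp add: unitary_group_def)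
  then have "ch g ^ ord g = 1"
    using mult_character_power[OF ch G(1) g, of "ord g"] gord by simp
  then obtain k where "k < ord g" "ch g = m ^ k"
    using power_root_of_unity[OF pos mo] primitive_root_of_reflection[OF u inv a] unfolding m_def by blast
  then have "k < ord g \<and> ch g = det g powi (- int k)" by (simp add: dinv)
  then have "char_exponent ch g < ord g \<and> ch g = det g powi (- int (char_exponent ch g))"
    unfolding char_exponent_def by (rule LeastI)
  then show "char_exponent ch g < ord g" "ch g = m ^ char_exponent ch g"
    by (simp_all add: dinv)
qed

section \<open>The logarithmic condition at a single hyperplane\<close>

lemma wedge_differential_dvd:
  fixes w :: "('n::{finite,linorder}, 'n mpoly) form"
  assumes G: "subgroup G unitary_group" "finite G" and ch: "mult_character G ch"
    and w: "w \<in> invariant_forms_deg G ch p"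
    and H: "hyperplane H" "linear_form_with_kernel f H"
    and g: "g \<in> pointwise_stabilizer G H"
  shows "\<exists>e\<in>homogeneous_forms (p + 1). wedge w (differential f) = f ^ char_exponent ch g *s e"
proof -
  from H(2) obtain a where f: "f = linear_poly a" and ker: "{v. (\<Sum>i\<in>UNIV. a $ i * v $ i) = 0} = H"
    by (auto simp: linear_form_with_kernel_def poly_value_linear_poly)
  have gG: "g \<in> G" and fix_H: "\<And>v. v \<in> H \<Longrightarrow> g *v v = v"
    using g by (auto simp: pointwise_stabilizer_def fixes_pointwise_def)
  then have u: "unitary_matrix g" using subgroup.subset[OF G(1)] by (auto simp: unitary_group_def)
  have a: "a \<noteq> 0"
  proof
    assume "a = 0"
    then have "H = UNIV" using ker by auto
    with H(1) show False by (simp add: hyperplane_def card_cart_basis)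
  qed
  \<comment> \<open>The inverse fixes \<open>H\<close> pointwise as well, so
    \<open>linear_form_factor\<close> applies to it.\<close>
  have "matrix_inv g *v v = v" if "(\<Sum>i\<in>UNIV. a $ i * v $ i) = 0" for v
    using fix_H[of v] that ker matrix_inv_unitary(2)[OF u]
    by (metis (mono_tags, lifting) matrix_vector_mul_assoc matrix_vector_mul_lid mem_Collect_eq)
  with a obtain c where inv: "matrix_inv g = mat 1 + rank_one c a"
    using linear_form_factor by blast
  note ce = char_exponent_spec[OF G ch gG inv a]
  let ?k = "char_exponent ch g" and ?t = "differential f"
  have t: "?t \<in> homogeneous_forms 1" unfolding f by (rule differential_linear_poly_homogeneous)
  have wh: "w \<in> homogeneous_forms p" and wi: "form_act g w = Const (ch g) *s w"
    using w gG by (auto simp: invariant_forms_deg_def)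
  \<comment> \<open>Compare coefficients in \<open>wedge_form_act\<close>, with invariance rewriting
    its left side.\<close>
  have "poly_act g (wedge w ?t $ K) = Const (ch g) * wedge w ?t $ K" for K
    using arg_cong[OF wedge_form_act[OF inv, of w], of "\<lambda>x. x $ K"]
    by (simp add: wi wedge_scale_left flip: f)
  moreover have "(1 + (\<Sum>i\<in>UNIV. a $ i * c $ i)) ^ j \<noteq> 1" if "0 < j" "j \<le> ?k" for j
    using that ce(1) by (intro primitive_root_of_reflection[OF u inv a]) auto
  ultimately have "f ^ ?k dvd wedge w ?t $ K" for K
    unfolding f by (intro linear_poly_power_dvd_of_poly_act[OF inv a ce(3)]) (simp_all flip: ce(2))
  then obtain e where e: "\<And>K. wedge w ?t $ K = f ^ ?k * e K"
    unfolding dvd_def by metis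
  have "f \<noteq> 0" using a f by simp
  \<comment> \<open>Outside degree \<open>p + 1\<close> the wedge vanishes, and the nonzero power of
    \<open>f\<close> cancels.\<close>
  then have "(\<chi> K. e K) \<in> homogeneous_forms (p + 1)"
    using wedge_homogeneous[OF wh t] by (auto simp: homogeneous_forms_def e)
  moreover have "wedge w ?t = f ^ ?k *s (\<chi> K. e K)"
    by (simp add: vec_eq_iff e)
  ultimately show ?thesis by blast
qed

section \<open>Invariant forms are logarithmic\<close>

lemma rational_form_sum: "rational_form (\<Sum>x\<in>P. f x) = (\<Sum>x\<in>P. rational_form (f x))"
  by (induction P rule: infinite_finite_induct) (simp_all add: rational_form_def vec_eq_iff)

theorem corollary3:
  fixes G :: "('n::{finite,linorder}) cmat set"
    and ch :: "'n cmat \<Rightarrow> complex"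
    and s :: "'n cvec set \<Rightarrow> 'n cmat"
    and \<alpha> :: "'n cvec set \<Rightarrow> 'n mpoly"
  defines "A \<equiv> reflecting_hyperplanes G"
    and "a \<equiv> \<lambda>H. char_exponent ch (s H)"
  assumes "reflection_group G"
    and "mult_character G ch"
    and "\<And>H. H \<in> A \<Longrightarrow> s H \<in> pointwise_stabilizer G H"
    and "\<And>H. H \<in> A \<Longrightarrow> generate unitary_group {s H} = pointwise_stabilizer G H"
    and "\<And>H. H \<in> A \<Longrightarrow> linear_form_with_kernel (\<alpha> H) H"
  shows "rational_form ` invariant_forms G ch
           \<subseteq> (\<lambda>\<eta>. to_fract (defining_poly A \<alpha> a) *s \<eta>) ` log_forms A \<alpha> a"
proof
  let ?Q = "to_fract (defining_poly A \<alpha> a)"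
  have hyp: "hyperplane H" if "H \<in> A" for H
    using that by (simp add: A_def reflecting_hyperplanes_def)
  have "\<alpha> H \<noteq> 0" if "H \<in> A" for H
  proof
    assume "\<alpha> H = 0"
    then have "H = UNIV" using assms(7)[OF that] by (simp add: linear_form_with_kernel_def)
    with hyp[OF that] show False by (simp add: hyperplane_def card_cart_basis)
  qed
  \<comment> \<open>A finite product of nonzero elements of a domain; over an infinite set the
    product is 1 by convention.\<close>
  then have Q: "?Q \<noteq> 0"
    by (induction A rule: infinite_finite_induct) (auto simp: defining_poly_def)
  fix x assume "x \<in> rational_form ` invariant_forms G ch"
  then obtain P w where P: "finite P" "\<forall>p\<in>P. w p \<in> invariant_forms_deg G ch p"
    and x: "x = rational_form (\<Sum>p\<in>P. w p)"
    by (auto simp: invariant_forms_def graded_sum_def)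
  have G: "subgroup G unitary_group" "finite G"
    using assms(3) by (auto simp: reflection_group_def)
  have "inverse ?Q *s rational_form (w p) \<in> log_forms_deg A \<alpha> a p" if "p \<in> P" for p
    using that P(2) wedge_differential_dvd[OF G assms(4) _ hyp assms(7) assms(5)]
    unfolding log_forms_deg_def a_def by (force simp: invariant_forms_deg_def)
  then have "(\<Sum>p\<in>P. inverse ?Q *s rational_form (w p)) \<in> log_forms A \<alpha> a"
    using P(1) by (auto simp: log_forms_def graded_sum_def)
  \<comment> \<open>Division by \<open>?Q\<close> was done degree by degree; multiplying back
    recovers the whole form.\<close>
  moreover have "x = ?Q *s (\<Sum>p\<in>P. inverse ?Q *s rational_form (w p))"
    using Q by (simp add: x rational_form_sum vec.scale_sum_right vector_smult_assoc)
  ultimately show "x \<in> (\<lambda>\<eta>. ?Q *s \<eta>) ` log_forms A \<alpha> a" by blast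
qed

end
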